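(* Let $(\Omega,\mathcal F,(\mathcal F_n)_{n=0,1,2,\dots})$ be a discrete-time filtered space with $\mathcal F=\bigvee_n\mathcal F_n$, and let $\mu,\nu$ and $P$ be probability measures on it such that $\mu\stackrel{loc}{\ll}P$ and $\nu\stackrel{loc}{\ll}P$. Let $z_n=d\mu_n/dP_n$, $z'_n=d\nu_n/dP_n$ and $Y_n(\alpha)=z_n^{\alpha}(z'_n)^{1-\alpha}$ for $\alpha\in(0,1)$. If $T$ is a stopping time, then $$\|(\mu_T)_a\|=\liminf_{n\to\infty,\ \alpha\to1-0}\Big[\sum_{k=0}^{n-1}\int_{\{T=k\}}Y_k(\alpha)\,dP_k+\int_{\{n\le T\}}Y_n(\alpha)\,dP_n\Big],$$ where $(\mu_T)_a$ is the absolutely continuous part of $\mu_T$ with respect to $\nu_T$.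
   Context: $T$ takes values in $\{0,1,2,\dots\}\cup\{\infty\}$. The subscript $n$ (resp. $T$) on a measure denotes restriction to $\mathcal F_n$ (resp. $\mathcal F_T$). $\mu\stackrel{loc}{\ll}P$ means $\mu_n\ll P_n$ for all $n$. $\|\cdot\|$ is the total variation norm. The double lower limit is defined by $$\liminf_{n\to\infty,\ \alpha\to1-0}f(\alpha,n)=\sup_{n\in\mathbb N,\ \beta\in(0,1)}\ \inf_{m\ge n,\ x\in[\beta,1)}f(x,m).$$ *)

theory Defs
  imports "HOL-Probability.Probability" "HOL-Probability.Stopping_Time"
begin

definition generated_algebra :: "'a set \<Rightarrow> (nat \<Rightarrow> 'a measure) \<Rightarrow> 'a measure" where
  "generated_algebra \<Omega> F = sigma \<Omega> (\<Union>n. sets (F n))"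

text \<open>
  Stopping times here may take the value \<open>\<infinity>\<close>. The library notions \<^const>\<open>stopping_time\<close> and
  \<^const>\<open>filtration.pre_sigma\<close> use one type for the time index and for the values of \<open>T\<close>, so the
  filtration is extended to index type \<^typ>\<open>enat\<close> by letting the value at \<open>\<infinity>\<close> be the join. The
  condition \<open>{T \<le> \<infinity>} \<in> F\<^sub>\<infinity>\<close> is then void, and \<open>F\<^sub>T\<close> consists of the \<open>A\<close> in the join
  such that \<open>A \<inter> {T \<le> n} \<in> F\<^sub>n\<close> for all finite \<open>n\<close>.
\<close>

definition enat_filtration :: "'a set \<Rightarrow> (nat \<Rightarrow> 'a measure) \<Rightarrow> enat \<Rightarrow> 'a measure" where
  "enat_filtration \<Omega> F t = (case t of enat n \<Rightarrow> F n | \<infinity> \<Rightarrow> generated_algebra \<Omega> F)"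

definition stopped_algebra :: "'a set \<Rightarrow> (nat \<Rightarrow> 'a measure) \<Rightarrow> ('a \<Rightarrow> enat) \<Rightarrow> 'a measure" where
  "stopped_algebra \<Omega> F T = filtration.pre_sigma \<Omega> (enat_filtration \<Omega> F) T"

text \<open>\<open>loc_absolutely_continuous F P \<mu>\<close> means that \<open>\<mu>\<close> is locally absolutely continuous with
  respect to \<open>P\<close>; the argument order is that of \<^const>\<open>absolutely_continuous\<close>.\<close>

definition loc_absolutely_continuous :: "(nat \<Rightarrow> 'a measure) \<Rightarrow> 'a measure \<Rightarrow> 'a measure \<Rightarrow> bool" where
  "loc_absolutely_continuous F P \<mu> \<longleftrightarrow>
     (\<forall>n. absolutely_continuous (restr_to_subalg P (F n)) (restr_to_subalg \<mu> (F n)))"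

definition mutually_singular :: "'a measure \<Rightarrow> 'a measure \<Rightarrow> bool" where
  "mutually_singular M N \<longleftrightarrow> (\<exists>A\<in>sets M. emeasure M A = 0 \<and> emeasure N (space M - A) = 0)"

definition lebesgue_decomposition :: "'a measure \<Rightarrow> 'a measure \<Rightarrow> 'a measure \<Rightarrow> 'a measure \<Rightarrow> bool" where
  "lebesgue_decomposition M N L S \<longleftrightarrow>
     sets L = sets N \<and> sets S = sets N \<and>
     (\<forall>A\<in>sets N. emeasure N A = emeasure L A + emeasure S A) \<and>
     absolutely_continuous M L \<and> mutually_singular M S"

text \<open>The absolutely continuous part of \<open>N\<close> with respect to \<open>M\<close>; it is well defined for finite
  measures by \<open>ex1_ac_part\<close> below.\<close>

definition ac_part :: "'a measure \<Rightarrow> 'a measure \<Rightarrow> 'a measure" where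
  "ac_part M N = (THE L. \<exists>S. lebesgue_decomposition M N L S)"

definition tv_norm :: "'a measure \<Rightarrow> ennreal" where
  "tv_norm M =
     (SUP \<A>\<in>{\<A>. finite \<A> \<and> \<A> \<subseteq> sets M \<and> partition_on (space M) \<A>}. \<Sum>A\<in>\<A>. emeasure M A)"

definition double_liminf :: "(real \<Rightarrow> nat \<Rightarrow> ennreal) \<Rightarrow> ennreal" where
  "double_liminf f = (SUP (n, \<beta>) \<in> UNIV \<times> {0<..<1}. INF (m, x) \<in> {n..} \<times> {\<beta>..<1}. f x m)"

definition Y_process ::
  "(nat \<Rightarrow> 'a \<Rightarrow> real) \<Rightarrow> (nat \<Rightarrow> 'a \<Rightarrow> real) \<Rightarrow> nat \<Rightarrow> real \<Rightarrow> 'a \<Rightarrow> real" where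
  "Y_process z z' n \<alpha> \<omega> = z n \<omega> powr \<alpha> * z' n \<omega> powr (1 - \<alpha>)"

lemma filtration_enat_filtration:
  assumes "filtration \<Omega> F"
  shows "filtration \<Omega> (enat_filtration \<Omega> F)"
proof -
  interpret filtration \<Omega> F by fact
  have sub: "(\<Union>n. sets (F n)) \<subseteq> Pow \<Omega>"
    using sets.space_closed[of "F _"] by (auto simp: space_F)
  show ?thesis
  proof
    show "space (enat_filtration \<Omega> F i) = \<Omega>" for i
      using sub by (cases i) (auto simp: enat_filtration_def generated_algebra_def space_F
          space_measure_of)
    show "sets (enat_filtration \<Omega> F i) \<le> sets (enat_filtration \<Omega> F j)" if "i \<le> j" for i j
      using that sub sets_F_mono
      by (cases i; cases j)
         (auto simp: enat_filtration_def generated_algebra_def sets_measure_of intro: sigma_sets.Basic)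
  qed
qed

lemma sets_stopped_algebra:
  assumes "filtration \<Omega> F" and "stopping_time (enat_filtration \<Omega> F) T"
  shows "sets (stopped_algebra \<Omega> F T) =
    {A \<in> sets (generated_algebra \<Omega> F). \<forall>n. {\<omega>\<in>A. T \<omega> \<le> enat n} \<in> sets (F n)}"
proof -
  have "(\<forall>t. {\<omega>\<in>A. T \<omega> \<le> t} \<in> sets (enat_filtration \<Omega> F t)) \<longleftrightarrow>
      A \<in> sets (generated_algebra \<Omega> F) \<and> (\<forall>n. {\<omega>\<in>A. T \<omega> \<le> enat n} \<in> sets (F n))" for A
  proof safe
    assume *: "\<forall>t. {\<omega>\<in>A. T \<omega> \<le> t} \<in> sets (enat_filtration \<Omega> F t)"
    show "A \<in> sets (generated_algebra \<Omega> F)"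
      using spec[OF *, of \<infinity>] by (simp add: enat_filtration_def)
    show "{\<omega>\<in>A. T \<omega> \<le> enat n} \<in> sets (F n)" for n
      using spec[OF *, of "enat n"] by (simp add: enat_filtration_def)
  next
    fix t assume "A \<in> sets (generated_algebra \<Omega> F)" "\<forall>n. {\<omega>\<in>A. T \<omega> \<le> enat n} \<in> sets (F n)"
    then show "{\<omega>\<in>A. T \<omega> \<le> t} \<in> sets (enat_filtration \<Omega> F t)"
      by (cases t) (auto simp: enat_filtration_def)
  qed
  then show ?thesis
    unfolding stopped_algebra_def
    by (simp add: filtration.sets_pre_sigma[OF filtration_enat_filtration[OF assms(1)] assms(2)])
qed

lemma ex1_ac_part:
  fixes M N :: "'a measure"
  assumes "finite_measure N" and [simp, measurable_cong]: "sets N = sets M"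
  shows "\<exists>!L. \<exists>S. lebesgue_decomposition M N L S"
proof -
  interpret N: finite_measure N by fact
  have sp [simp]: "space N = space M" by (rule sets_eq_imp_space_eq) simp
  have ne: "null_sets M \<noteq> {}" by auto
  define s where "s = (SUP A\<in>null_sets M. emeasure N A)"
  obtain f :: "nat \<Rightarrow> ennreal" where f: "range f \<subseteq> emeasure N ` null_sets M" "s = (SUP i. f i)"
    unfolding s_def using ne by (metis (no_types, lifting) ennreal_Sup_countable_SUP image_is_empty)
  then have "\<forall>i. \<exists>A\<in>null_sets M. f i = emeasure N A" by blast
  then obtain A where A: "\<And>i. A i \<in> null_sets M" "\<And>i. f i = emeasure N (A i)" by metis
  define B where "B = (\<Union>i. A i)"
  have B: "B \<in> null_sets M" unfolding B_def using A(1) by auto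
  have [measurable]: "B \<in> sets M" using B by auto
  have Bs: "s \<le> emeasure N B"
    unfolding f(2) A(2) B_def using A(1) by (intro SUP_least emeasure_mono) auto
  define L where "L = density N (indicator (space M - B))"
  define S where "S = density N (indicator B)"
  have eL: "emeasure L C = emeasure N (C - B)" if [measurable]: "C \<in> sets M" for C
  proof -
    have "emeasure L C = (\<integral>\<^sup>+x. indicator (space M - B) x * indicator C x \<partial>N)"
      unfolding L_def by (rule emeasure_density) measurable
    also have "\<dots> = (\<integral>\<^sup>+x. indicator (C - B) x \<partial>N)"
      by (intro nn_integral_cong) (auto split: split_indicator)
    finally show ?thesis by simp
  qed
  have eS: "emeasure S C = emeasure N (C \<inter> B)" if [measurable]: "C \<in> sets M" for C
  proof -
    have "emeasure S C = (\<integral>\<^sup>+x. indicator B x * indicator C x \<partial>N)"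
      unfolding S_def by (rule emeasure_density) measurable
    also have "\<dots> = (\<integral>\<^sup>+x. indicator (C \<inter> B) x \<partial>N)"
      by (intro nn_integral_cong) (auto split: split_indicator)
    finally show ?thesis by simp
  qed
  have "lebesgue_decomposition M N L S"
    unfolding lebesgue_decomposition_def
  proof (intro conjI ballI)
    show "sets L = sets N" "sets S = sets N" by (simp_all add: L_def S_def)
    show "emeasure N C = emeasure L C + emeasure S C" if "C \<in> sets N" for C
    proof -
      have "emeasure N ((C - B) \<union> (C \<inter> B)) = emeasure N (C - B) + emeasure N (C \<inter> B)"
        using that by (intro plus_emeasure[symmetric]) auto
      moreover have "(C - B) \<union> (C \<inter> B) = C" by blast
      ultimately show ?thesis using that by (simp add: eL eS)
    qed
    show "mutually_singular M S"
      unfolding mutually_singular_def using B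
      by (intro bexI[of _ B]) (auto simp: eS null_setsD1 Diff_Int_distrib2)
    show "absolutely_continuous M L"
      unfolding absolutely_continuous_def
    proof
      fix C assume C: "C \<in> null_sets M"
      have CM: "C \<in> sets M" using C by auto
      have "C \<union> B \<in> null_sets M" using C B by auto
      then have "emeasure N (C \<union> B) \<le> s" unfolding s_def by (rule SUP_upper)
      moreover have "emeasure N ((C - B) \<union> B) = emeasure N (C - B) + emeasure N B"
        using CM by (intro plus_emeasure[symmetric]) auto
      moreover have "(C - B) \<union> B = C \<union> B" by blast
      ultimately have "emeasure N (C - B) + emeasure N B \<le> 0 + emeasure N B"
        using Bs by (metis add_0 order_trans)
      then have "emeasure N (C - B) = 0"
        using N.emeasure_finite[of B] by (simp add: ennreal_add_left_cancel_le add.commute)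
      then show "C \<in> null_sets L"
        using CM by (simp add: null_sets_def eL) (simp add: L_def)
    qed
  qed
  moreover have "L1 = L2"
    if 1: "lebesgue_decomposition M N L1 S1" and 2: "lebesgue_decomposition M N L2 S2"
    for L1 L2 S1 S2
  proof (rule measure_eqI)
    show "sets L1 = sets L2" using 1 2 by (simp add: lebesgue_decomposition_def)
    obtain B1 where B1: "B1 \<in> null_sets M" "emeasure S1 (space M - B1) = 0"
      using 1 by (auto simp: lebesgue_decomposition_def mutually_singular_def)
    obtain B2 where B2: "B2 \<in> null_sets M" "emeasure S2 (space M - B2) = 0"
      using 2 by (auto simp: lebesgue_decomposition_def mutually_singular_def)
    have key: "emeasure L' C = emeasure N (C - (B1 \<union> B2))"
      if d: "lebesgue_decomposition M N L' S'" and C: "C \<in> sets M"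
        and B': "B' \<subseteq> B1 \<union> B2" "B' \<in> sets M" "emeasure S' (space M - B') = 0" for L' S' B' C
    proof -
      have [simp]: "sets L' = sets M" "sets S' = sets M"
        using d by (auto simp: lebesgue_decomposition_def)
      have U: "B1 \<union> B2 \<in> null_sets M" using B1 B2 by auto
      have "B1 \<union> B2 \<in> null_sets L'"
        using d U by (auto simp: lebesgue_decomposition_def absolutely_continuous_def)
      then have "emeasure L' C = emeasure L' (C - (B1 \<union> B2))"
        using C by (intro emeasure_Diff_null_set[symmetric]) auto
      moreover have "emeasure S' (C - (B1 \<union> B2)) \<le> emeasure S' (space M - B')"
        using C B' sets.sets_into_space[OF C] by (intro emeasure_mono) auto
      moreover have "emeasure N (C - (B1 \<union> B2)) = emeasure L' (C - (B1 \<union> B2)) + emeasure S' (C - (B1 \<union> B2))"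
        using d C U by (auto simp: lebesgue_decomposition_def)
      ultimately show ?thesis using B' by simp
    qed
    fix C assume "C \<in> sets L1"
    then have C: "C \<in> sets M" using 1 by (simp add: lebesgue_decomposition_def)
    show "emeasure L1 C = emeasure L2 C"
      using key[OF 1 C, of B1] key[OF 2 C, of B2] B1 B2 null_setsD2[OF B1(1)] null_setsD2[OF B2(1)] by simp
  qed
  ultimately show ?thesis by blast
qed

end

theory Submission
  imports Defs
begin

text \<open>
  The bracket equals \<open>H(\<alpha>,n) = \<integral> Z\<^sup>\<alpha> Z'\<^sup>1\<^sup>-\<^sup>\<alpha> dP\<close>, where \<open>Z\<close>, \<open>Z'\<close> are \<open>z\<close>, \<open>z'\<close> evaluated at time
  \<open>min T n\<close>, i.e. the densities of \<open>\<mu>\<close>, \<open>\<nu>\<close> on the events known at that time. Let \<open>B\<close> be a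
  \<open>\<nu>\<close>-null event of the stopped \<open>\<sigma>\<close>-algebra that carries the singular part of \<open>\<mu>\<close>, so that the norm
  in question is \<open>m = \<mu>(\<Omega> - B)\<close>. No martingale convergence is needed.

  Upper bound: approximate \<open>B\<close> by an event \<open>A\<close> known at time \<open>min T n\<close>. The scaled Young inequality
  \<open>a\<^sup>x b\<^sup>1\<^sup>-\<^sup>x \<le> x c\<^sup>x\<^sup>-\<^sup>1 a + (1 - x) c\<^sup>x b\<close>, with \<open>c = 1\<close> off \<open>A\<close> and \<open>c\<close> large on \<open>A\<close>, gives
  \<open>H(x,n) \<le> \<mu>(\<Omega> - A) + (1 - x) + c\<^sup>x\<^sup>-\<^sup>1 + c\<^sup>x \<nu>(A)\<close>, which is close to \<open>m\<close>.

  Lower bound: on \<open>D = {Z \<le> K Z'}\<close> the integrand is at least \<open>K\<^sup>x\<^sup>-\<^sup>1 Z\<close>, while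
  \<open>\<nu>(\<Omega> - D) \<le> 1/K\<close>; hence the absolutely continuous part of \<open>\<mu>\<close> gives \<open>\<Omega> - D\<close> small mass,
  uniformly in \<open>n\<close>, and \<open>H(x,n) \<ge> K\<^sup>x\<^sup>-\<^sup>1 \<mu>(D)\<close> is almost \<open>m\<close> as \<open>x\<close> tends to 1.
\<close>

section \<open>Total variation and absolutely continuous parts\<close>

text \<open>For a positive measure every finite partition sum is the total mass, by additivity. The
  norm in the theorem is thus the mass of one event.\<close>

lemma tv_norm_eq_emeasure_space: "tv_norm M = emeasure M (space M)"
proof (rule antisym)
  show "tv_norm M \<le> emeasure M (space M)"
    unfolding tv_norm_def
  proof (rule SUP_least, clarify)
    fix \<A> assume A: "finite \<A>" "\<A> \<subseteq> sets M" "partition_on (space M) \<A>"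
    have "(\<Sum>A\<in>\<A>. emeasure M A) = emeasure M (\<Union>A\<in>\<A>. A)"
      using A partition_onD2[OF A(3)]
      by (intro sum_emeasure) (auto simp: disjoint_family_on_def disjoint_def)
    then show "(\<Sum>A\<in>\<A>. emeasure M A) \<le> emeasure M (space M)"
      using partition_onD1[OF A(3)] by simp
  qed
  show "emeasure M (space M) \<le> tv_norm M"
  \<comment> \<open>A partition has no empty block, so \<open>{space M}\<close> is one only if the
    space is non-empty.\<close>
  proof (cases "space M = {}")
    case False
    then show ?thesis
      unfolding tv_norm_def by (intro SUP_upper2[of "{space M}"]) (auto intro: partition_on_space)
  qed simp
qed

text \<open>The singular part lives on an \<open>M\<close>-null set \<open>B\<close>. Absolute
  continuity makes \<open>B\<close> null for \<open>ac_part M N\<close> too, so removing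
  \<open>B\<close> from an event discards the singular part and leaves the other unchanged.\<close>

lemma ac_part_emeasure:
  assumes N: "finite_measure N" and sets: "sets N = sets M"
  obtains B where "B \<in> null_sets M" "absolutely_continuous M (ac_part M N)"
    "sets (ac_part M N) = sets M"
    "\<And>A. A \<in> sets M \<Longrightarrow> emeasure (ac_part M N) A = emeasure N (A - B)"
proof -
  let ?L = "ac_part M N"
  obtain S where d: "lebesgue_decomposition M N ?L S"
    using theI'[OF ex1_ac_part[OF N sets]] unfolding ac_part_def by blast
  then obtain B where B: "B \<in> null_sets M" "emeasure S (space M - B) = 0"
    by (auto simp: lebesgue_decomposition_def mutually_singular_def)
  have [simp]: "sets ?L = sets M" "sets S = sets M" and ac: "absolutely_continuous M ?L"
    using d sets by (auto simp: lebesgue_decomposition_def)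
  have "emeasure ?L A = emeasure N (A - B)" if A: "A \<in> sets M" for A
  proof -
    have "B \<in> null_sets ?L"
      using ac B by (auto simp: absolutely_continuous_def)
    then have "emeasure ?L A = emeasure ?L (A - B)"
      using A by (intro emeasure_Diff_null_set[symmetric]) auto
    moreover have "emeasure S (A - B) \<le> emeasure S (space M - B)"
      using A B(1) sets.sets_into_space[OF A] by (intro emeasure_mono) auto
    moreover have "emeasure N (A - B) = emeasure ?L (A - B) + emeasure S (A - B)"
      using d A B(1) sets by (auto simp: lebesgue_decomposition_def)
    ultimately show ?thesis using B by simp
  qed
  then show ?thesis using that B ac by simp
qed

text \<open>Otherwise there are sets \<open>C i\<close> of \<open>N\<close>-measure at most
  \<open>(1/2)^i\<close> and \<open>L\<close>-measure at least \<open>e\<close>. By Borel-Cantelli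
  their limsup is \<open>N\<close>-null, hence \<open>L\<close>-null, whereas continuity from above
  for the finite \<open>L\<close> gives it mass at least \<open>e\<close>.\<close>

lemma absolutely_continuous_epsilon_delta:
  assumes "finite_measure L" "finite_measure N" "absolutely_continuous N L"
    and [measurable_cong]: "sets L = sets N" and "0 < (e::real)"
  obtains d :: real where "0 < d" "\<And>C. C \<in> sets N \<Longrightarrow> measure N C \<le> d \<Longrightarrow> measure L C < e"
proof (rule ccontr)
  interpret L: finite_measure L by fact
  interpret N: finite_measure N by fact
  assume "\<not> thesis"
  with that have "\<exists>C. C \<in> sets N \<and> measure N C \<le> d \<and> e \<le> measure L C" if "0 < d" for d
    using that by (meson not_le)
  from this[of "(1/2)^i" for i] obtain C
    where C: "\<And>i::nat. C i \<in> sets N" "\<And>i. measure N (C i) \<le> (1/2)^i" "\<And>i. e \<le> measure L (C i)"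
    by (metis zero_less_divide_1_iff zero_less_numeral zero_less_power)
  have CL: "C i \<in> sets L" for i using C(1) assms(4) by simp
  have "summable (\<lambda>i. measure N (C i))"
    by (rule summable_comparison_test[of _ "\<lambda>i. (1/2)^i"]) (use C(2) in auto)
  then have "limsup C \<in> null_sets N"
    by (intro borel_cantelli_limsup1) (use C(1) in \<open>auto simp: N.emeasure_eq_measure\<close>)
  then have "limsup C \<in> null_sets L"
    using assms(3) by (auto simp: absolutely_continuous_def)
  then have 0: "measure L (limsup C) = 0" by (simp add: measure_eq_0_null_sets)
  define D where "D n = (\<Union>i\<in>{n..}. C i)" for n
  have "(\<lambda>n. measure L (D n)) \<longlonglongrightarrow> measure L (\<Inter>n. D n)"
    using CL by (intro L.finite_Lim_measure_decseq) (fastforce simp: D_def decseq_def)+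
  moreover have "(\<Inter>n. D n) = limsup C" by (simp add: limsup_INF_SUP D_def)
  moreover have "e \<le> measure L (D n)" for n
  proof -
    have "measure L (C n) \<le> measure L (D n)"
      using CL by (intro L.finite_measure_mono) (auto simp: D_def)
    with C(3)[of n] show ?thesis by linarith
  qed
  ultimately have "e \<le> measure L (limsup C)"
    by (intro LIMSEQ_le_const) auto
  with 0 \<open>0 < e\<close> show False by simp
qed

section \<open>Pointwise bounds for weighted geometric means\<close>

text \<open>Young's inequality for \<open>a\<close> and \<open>c * b\<close>, multiplied by
  \<open>c powr (x - 1)\<close>. The free weight \<open>c\<close> shifts the bound between
  \<open>a\<close> and \<open>b\<close>: a large \<open>c\<close> makes the coefficient of
  \<open>a\<close> small.\<close>

lemma powr_geometric_mean_le:
  fixes a b c x :: real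
  assumes "0 \<le> a" "0 \<le> b" "0 < c" "0 < x" "x < 1"
  shows "a powr x * b powr (1 - x) \<le> c powr (x - 1) * a * x + c powr x * b * (1 - x)"
proof -
  have "a powr x * (c * b) powr (1 - x) \<le> x * a + (1 - x) * (c * b)"
  proof (cases "a = 0 \<or> b = 0")
    case False
    then show ?thesis using assms by (intro Youngs_inequality_0) auto
  qed (use assms in auto)
  then have "c powr (x - 1) * (a powr x * (c * b) powr (1 - x)) \<le> c powr (x - 1) * (x * a + (1 - x) * (c * b))"
    by (intro mult_left_mono) auto
  moreover have "c powr (x - 1) * (c * b) powr (1 - x) = b powr (1 - x)"
    using assms by (simp add: powr_mult powr_diff)
  moreover have "c powr (x - 1) * c = c powr x"
    using assms by (simp add: powr_diff)
  moreover have "c powr (x - 1) * (a powr x * (c * b) powr (1 - x)) =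
      a powr x * (c powr (x - 1) * (c * b) powr (1 - x))"
    "c powr (x - 1) * (x * a + (1 - x) * (c * b)) =
      c powr (x - 1) * a * x + (c powr (x - 1) * c) * b * (1 - x)"
    by (simp_all add: algebra_simps)
  ultimately show ?thesis by metis
qed

text \<open>The constraint says \<open>b \<ge> a / K\<close>, and the mean increases with
  \<open>b\<close>; at \<open>b = a / K\<close> it equals the left side.\<close>

lemma powr_geometric_mean_ge:
  fixes a b K x :: real
  assumes "0 \<le> a" "0 < K" "a \<le> K * b" "x < 1"
  shows "K powr (x - 1) * a \<le> a powr x * b powr (1 - x)"
proof (cases "a = 0")
  case False
  with assms have "0 < a" by simp
  have "K powr (x - 1) * a = a powr x * (a / K) powr (1 - x)"
    using \<open>0 < a\<close> assms by (simp add: powr_divide powr_diff field_simps)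
  also have "\<dots> \<le> a powr x * b powr (1 - x)"
    using assms \<open>0 < a\<close> by (intro mult_left_mono powr_mono2) (auto simp: field_simps)
  finally show ?thesis .
qed simp


section \<open>Events and processes at the bounded time \<open>min T n\<close>\<close>

locale stopped_filtration = filtration \<Omega> F for \<Omega> :: "'a set" and F :: "nat \<Rightarrow> 'a measure" +
  fixes T :: "'a \<Rightarrow> enat"
  assumes stopping: "stopping_time (enat_filtration \<Omega> F) T"
begin

lemma sets_subset_Pow: "(\<Union>n. sets (F n)) \<subseteq> Pow \<Omega>"
  using sets.space_closed[of "F _"] by (auto simp: space_F)

lemma space_generated_algebra: "space (generated_algebra \<Omega> F) = \<Omega>"
  unfolding generated_algebra_def using sets_subset_Pow by (simp add: space_measure_of)

lemma sets_generated_algebra: "sets (generated_algebra \<Omega> F) = sigma_sets \<Omega> (\<Union>n. sets (F n))"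
  unfolding generated_algebra_def using sets_subset_Pow by (simp add: sets_measure_of)

lemma subalgebra_F:
  assumes "sets M = sets (generated_algebra \<Omega> F)"
  shows "subalgebra M (F n)"
  using assms sets_eq_imp_space_eq[OF assms]
  by (auto simp: subalgebra_def space_F space_generated_algebra sets_generated_algebra
      intro: sigma_sets.Basic)

lemma subalgebra_stopped_algebra:
  assumes "sets M = sets (generated_algebra \<Omega> F)"
  shows "subalgebra M (stopped_algebra \<Omega> F T)"
proof -
  have "space (stopped_algebra \<Omega> F T) = \<Omega>"
    unfolding stopped_algebra_def
    by (rule filtration.space_pre_sigma[OF filtration_enat_filtration[OF filtration_axioms]])
  then show ?thesis
    using assms sets_eq_imp_space_eq[OF assms]
    by (auto simp: subalgebra_def space_generated_algebra
        sets_stopped_algebra[OF filtration_axioms stopping])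
qed

lemma le_sets_F: "{\<omega>\<in>\<Omega>. T \<omega> \<le> enat n} \<in> sets (F n)"
  using stopping_timeD[OF stopping, of "enat n"]
  by (simp add: enat_filtration_def pred_def space_F)

lemma ge_sets_F: "{\<omega>\<in>\<Omega>. enat n \<le> T \<omega>} \<in> sets (F n)"
proof (cases n)
  case 0
  then show ?thesis using sets.top[of "F n"] by (simp add: space_F zero_enat_def[symmetric])
next
  case (Suc k)
  have "space (F n) - {\<omega>\<in>\<Omega>. T \<omega> \<le> enat k} \<in> sets (F n)"
    using le_sets_F[of k] sets_F_mono[of k n] Suc by auto
  also have "space (F n) - {\<omega>\<in>\<Omega>. T \<omega> \<le> enat k} = {\<omega>\<in>\<Omega>. enat n \<le> T \<omega>}"
    unfolding Suc Suc_ile_eq space_F by (auto simp: not_le)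
  finally show ?thesis .
qed

lemma eq_sets_F: "{\<omega>\<in>\<Omega>. T \<omega> = enat n} \<in> sets (F n)"
proof -
  have "{\<omega>\<in>\<Omega>. T \<omega> = enat n} = {\<omega>\<in>\<Omega>. T \<omega> \<le> enat n} \<inter> {\<omega>\<in>\<Omega>. enat n \<le> T \<omega>}" by auto
  then show ?thesis using le_sets_F ge_sets_F by auto
qed

text \<open>The \<open>\<sigma>\<close>-algebra of the bounded stopping time \<open>min T n\<close>, described by its traces on
  \<open>{T = k}\<close> for \<open>k < n\<close> and on \<open>{n \<le> T}\<close>.\<close>

definition bounded_events :: "nat \<Rightarrow> 'a set set" where
  "bounded_events n = {A. A \<subseteq> \<Omega> \<and> (\<forall>k<n. {\<omega>\<in>A. T \<omega> = enat k} \<in> sets (F k)) \<and>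
     {\<omega>\<in>A. enat n \<le> T \<omega>} \<in> sets (F n)}"

text \<open>This is \<open>g\<close> at time \<open>min T n\<close>. The first branch covers
  \<open>T \<omega> = \<infinity>\<close>, so \<open>the_enat\<close> only meets finite values. The
  value type is arbitrary, to serve densities and predicates alike.\<close>

definition stopped_value :: "(nat \<Rightarrow> 'a \<Rightarrow> 'b) \<Rightarrow> nat \<Rightarrow> 'a \<Rightarrow> 'b" where
  "stopped_value g n \<omega> = (if enat n \<le> T \<omega> then g n \<omega> else g (the_enat (T \<omega>)) \<omega>)"

lemma bounded_events_decompose:
  assumes "A \<subseteq> \<Omega>"
  shows "A = (\<Union>k<n. {\<omega>\<in>A. T \<omega> = enat k}) \<union> {\<omega>\<in>A. enat n \<le> T \<omega>}"
proof -
  have "\<exists>k<n. T \<omega> = enat k" if "\<not> enat n \<le> T \<omega>" for \<omega>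
    using that by (cases "T \<omega>") auto
  then show ?thesis by fastforce
qed

lemma bounded_events_Compl:
  assumes "A \<in> bounded_events n"
  shows "\<Omega> - A \<in> bounded_events n"
proof -
  have "{\<omega>\<in>\<Omega> - A. T \<omega> = enat j} = {\<omega>\<in>\<Omega>. T \<omega> = enat j} - {\<omega>\<in>A. T \<omega> = enat j}"
    "{\<omega>\<in>\<Omega> - A. enat j \<le> T \<omega>} = {\<omega>\<in>\<Omega>. enat j \<le> T \<omega>} - {\<omega>\<in>A. enat j \<le> T \<omega>}" for j
    by auto
  then show ?thesis using assms eq_sets_F ge_sets_F by (auto simp: bounded_events_def)
qed

lemma bounded_events_sets_F:
  assumes "A \<in> bounded_events n"
  shows "A \<in> sets (F n)"
proof -
  have "(\<Union>k<n. {\<omega>\<in>A. T \<omega> = enat k}) \<union> {\<omega>\<in>A. enat n \<le> T \<omega>} \<in> sets (F n)"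
    using assms sets_F_mono[of _ n] unfolding bounded_events_def
    by (intro sets.Un sets.finite_UN) (auto intro: less_imp_le)
  then show ?thesis
    using bounded_events_decompose[of A n] assms by (simp add: bounded_events_def)
qed

text \<open>For \<open>n \<le> m\<close>, both \<open>A\<close> and \<open>{T \<le> m}\<close> are
  already in \<open>F m\<close>. For \<open>m < n\<close>, the trace on \<open>{T \<le> m}\<close>
  is a finite union of traces on \<open>{T = k}\<close> with \<open>k \<le> m\<close>, each in
  \<open>F k\<close>.\<close>

lemma bounded_events_stopped_algebra:
  assumes A: "A \<in> bounded_events n"
  shows "A \<in> sets (stopped_algebra \<Omega> F T)"
  unfolding sets_stopped_algebra[OF filtration_axioms stopping]
proof (intro CollectI conjI allI)
  show "A \<in> sets (generated_algebra \<Omega> F)"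
    using bounded_events_sets_F[OF A] by (auto simp: sets_generated_algebra)
  fix m
  show "{\<omega>\<in>A. T \<omega> \<le> enat m} \<in> sets (F m)"
  proof (cases "n \<le> m")
    case True
    then have "A \<inter> {\<omega>\<in>\<Omega>. T \<omega> \<le> enat m} \<in> sets (F m)"
      using le_sets_F[of m] bounded_events_sets_F[OF A] sets_F_mono[of n m] by auto
    moreover have "A \<inter> {\<omega>\<in>\<Omega>. T \<omega> \<le> enat m} = {\<omega>\<in>A. T \<omega> \<le> enat m}"
      using A by (auto simp: bounded_events_def)
    ultimately show ?thesis by simp
  next
    case False
    have "(\<Union>k\<le>m. {\<omega>\<in>A. T \<omega> = enat k}) \<in> sets (F m)"
    proof (intro sets.finite_UN)
      fix k assume "k \<in> {..m}"
      then have "{\<omega>\<in>A. T \<omega> = enat k} \<in> sets (F k)" "k \<le> m"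
        using A False by (auto simp: bounded_events_def)
      then show "{\<omega>\<in>A. T \<omega> = enat k} \<in> sets (F m)"
        using sets_F_mono by blast
    qed simp
    moreover have "(\<Union>k\<le>m. {\<omega>\<in>A. T \<omega> = enat k}) = {\<omega>\<in>A. T \<omega> \<le> enat m}"
      using enat_ile by fastforce
    ultimately show ?thesis by simp
  qed
qed

text \<open>A condition observable at each fixed time is observable at \<open>min T n\<close>. This
  yields measurability of stopped processes and, later, the event comparing the two stopped
  densities.\<close>

lemma stopped_value_pred_bounded_events:
  assumes "\<And>k. k \<le> n \<Longrightarrow> {\<omega>\<in>\<Omega>. R k \<omega>} \<in> sets (F k)"
  shows "{\<omega>\<in>\<Omega>. stopped_value R n \<omega>} \<in> bounded_events n"
  unfolding bounded_events_def
proof (intro CollectI conjI allI impI)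
  fix k assume "k < n"
  have "{\<omega> \<in> {\<omega>\<in>\<Omega>. stopped_value R n \<omega>}. T \<omega> = enat k} = {\<omega>\<in>\<Omega>. R k \<omega>} \<inter> {\<omega>\<in>\<Omega>. T \<omega> = enat k}"
    using \<open>k < n\<close> by (auto simp: stopped_value_def)
  also have "\<dots> \<in> sets (F k)"
    using assms[of k] \<open>k < n\<close> eq_sets_F[of k] by auto
  finally show "{\<omega> \<in> {\<omega>\<in>\<Omega>. stopped_value R n \<omega>}. T \<omega> = enat k} \<in> sets (F k)" .
next
  have "{\<omega> \<in> {\<omega>\<in>\<Omega>. stopped_value R n \<omega>}. enat n \<le> T \<omega>} = {\<omega>\<in>\<Omega>. R n \<omega>} \<inter> {\<omega>\<in>\<Omega>. enat n \<le> T \<omega>}"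
    by (auto simp: stopped_value_def)
  also have "\<dots> \<in> sets (F n)"
    using assms[of n] ge_sets_F[of n] by auto
  finally show "{\<omega> \<in> {\<omega>\<in>\<Omega>. stopped_value R n \<omega>}. enat n \<le> T \<omega>} \<in> sets (F n)" .
qed auto

text \<open>At each point at most one indicator on the right is non-zero. This is the pointwise form
  of the bracket in the theorem.\<close>

lemma stopped_value_decompose:
  fixes g :: "nat \<Rightarrow> 'a \<Rightarrow> ennreal"
  shows "stopped_value g n \<omega> * indicator A \<omega> =
    (\<Sum>k<n. g k \<omega> * indicator {\<omega>\<in>A. T \<omega> = enat k} \<omega>) + g n \<omega> * indicator {\<omega>\<in>A. enat n \<le> T \<omega>} \<omega>"
proof (cases "enat n \<le> T \<omega>")
  case True
  then have "indicator {\<omega>\<in>A. T \<omega> = enat k} \<omega> = (0::ennreal)" if "k < n" for k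
    using that by (auto simp: indicator_def)
  then have "(\<Sum>k<n. g k \<omega> * indicator {\<omega>\<in>A. T \<omega> = enat k} \<omega>) = 0"
    by (intro sum.neutral) auto
  with True show ?thesis by (simp add: stopped_value_def indicator_def)
next
  case False
  then obtain j where j: "T \<omega> = enat j" "j < n" by (cases "T \<omega>") auto
  have "(\<Sum>k<n. g k \<omega> * indicator {\<omega>\<in>A. T \<omega> = enat k} \<omega>) = (\<Sum>k<n. if j = k then g k \<omega> * indicator A \<omega> else 0)"
    using j by (intro sum.cong) (auto simp: indicator_def)
  then show ?thesis using j False by (simp add: stopped_value_def)
qed

text \<open>Each integrand on the right is \<open>F k\<close>-measurable, so the restricted measures
  can be replaced by \<open>M\<close>; the pointwise decomposition is then integrated term by
  term.\<close>

lemma nn_integral_stopped_value: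
  fixes g :: "nat \<Rightarrow> 'a \<Rightarrow> ennreal"
  assumes M: "sets M = sets (generated_algebra \<Omega> F)"
    and g: "\<And>k. g k \<in> borel_measurable (F k)"
    and A: "A \<in> bounded_events n"
  shows "(\<integral>\<^sup>+\<omega>\<in>A. stopped_value g n \<omega> \<partial>M) =
    (\<Sum>k<n. \<integral>\<^sup>+\<omega>\<in>{\<omega>\<in>A. T \<omega> = enat k}. g k \<omega> \<partial>restr_to_subalg M (F k)) +
    (\<integral>\<^sup>+\<omega>\<in>{\<omega>\<in>A. enat n \<le> T \<omega>}. g n \<omega> \<partial>restr_to_subalg M (F n))"
proof -
  have m: "(\<lambda>\<omega>. g k \<omega> * indicator B \<omega>) \<in> borel_measurable (F k)" if "B \<in> sets (F k)" for k B
    using g that by measurable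
  have r: "(\<integral>\<^sup>+\<omega>\<in>B. g k \<omega> \<partial>restr_to_subalg M (F k)) = (\<integral>\<^sup>+\<omega>\<in>B. g k \<omega> \<partial>M)"
    if "B \<in> sets (F k)" for k B
    using nn_integral_subalgebra2[OF subalgebra_F[OF M] m[OF that]] .
  have m': "(\<lambda>\<omega>. g k \<omega> * indicator B \<omega>) \<in> borel_measurable M" if "B \<in> sets (F k)" for k B
    using measurable_from_subalg[OF subalgebra_F[OF M] m[OF that]] .
  have B: "\<And>k. k < n \<Longrightarrow> {\<omega>\<in>A. T \<omega> = enat k} \<in> sets (F k)" "{\<omega>\<in>A. enat n \<le> T \<omega>} \<in> sets (F n)"
    using A by (auto simp: bounded_events_def)
  have "(\<integral>\<^sup>+\<omega>\<in>A. stopped_value g n \<omega> \<partial>M) =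
      (\<integral>\<^sup>+\<omega>. (\<Sum>k<n. g k \<omega> * indicator {\<omega>\<in>A. T \<omega> = enat k} \<omega>) \<partial>M) +
      (\<integral>\<^sup>+\<omega>\<in>{\<omega>\<in>A. enat n \<le> T \<omega>}. g n \<omega> \<partial>M)"
    unfolding stopped_value_decompose using B
    by (intro nn_integral_add borel_measurable_sum m') auto
  also have "(\<integral>\<^sup>+\<omega>. (\<Sum>k<n. g k \<omega> * indicator {\<omega>\<in>A. T \<omega> = enat k} \<omega>) \<partial>M) =
      (\<Sum>k<n. \<integral>\<^sup>+\<omega>\<in>{\<omega>\<in>A. T \<omega> = enat k}. g k \<omega> \<partial>M)"
    using B by (intro nn_integral_sum m') auto
  finally show ?thesis using B by (simp add: r)
qed

lemma stopped_value_measurable: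
  assumes g: "\<And>k. g k \<in> measurable (F k) N"
  shows "stopped_value g n \<in> measurable (F n) N"
proof (rule measurableI)
  fix S assume S: "S \<in> sets N"
  have "{\<omega>\<in>\<Omega>. stopped_value (\<lambda>k \<omega>. g k \<omega> \<in> S) n \<omega>} \<in> bounded_events n"
  proof (rule stopped_value_pred_bounded_events)
    show "{\<omega>\<in>\<Omega>. g k \<omega> \<in> S} \<in> sets (F k)" for k
      using measurable_sets[OF g[of k] S] by (simp add: vimage_def Int_def space_F conj_commute)
  qed
  moreover have "{\<omega>\<in>\<Omega>. stopped_value (\<lambda>k \<omega>. g k \<omega> \<in> S) n \<omega>} = stopped_value g n -` S \<inter> space (F n)"
    by (auto simp: stopped_value_def space_F)
  ultimately show "stopped_value g n -` S \<inter> space (F n) \<in> sets (F n)"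
    using bounded_events_sets_F by simp
next
  fix \<omega> assume "\<omega> \<in> space (F n)"
  then show "stopped_value g n \<omega> \<in> space N"
    using measurable_space[OF g] by (simp add: stopped_value_def space_F)
qed

text \<open>The density of \<open>Q\<close> at time \<open>min T n\<close> is the stopped density
  process. On each trace of \<open>A\<close> this is the Radon-Nikodym identity in
  \<open>F k\<close> with \<open>k \<le> n\<close>, which is where local absolute continuity enters;
  the disjoint traces add up to \<open>A\<close>.\<close>

lemma emeasure_bounded_events:
  assumes P: "finite_measure P" "sets P = sets (generated_algebra \<Omega> F)"
    and Q: "sets Q = sets (generated_algebra \<Omega> F)"
    and ac: "loc_absolutely_continuous F P Q"
    and z: "\<And>n. z n \<in> borel_measurable (F n)"
    and RN: "\<And>n. AE \<omega> in restr_to_subalg P (F n).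
           ennreal (z n \<omega>) = RN_deriv (restr_to_subalg P (F n)) (restr_to_subalg Q (F n)) \<omega>"
    and A: "A \<in> bounded_events n"
  shows "(\<integral>\<^sup>+\<omega>\<in>A. ennreal (stopped_value z n \<omega>) \<partial>P) = emeasure Q A"
proof -
  have dens: "(\<integral>\<^sup>+\<omega>\<in>C. ennreal (z k \<omega>) \<partial>restr_to_subalg P (F k)) = emeasure Q C"
    if C: "C \<in> sets (F k)" for k C
  proof -
    let ?P = "restr_to_subalg P (F k)" and ?Q = "restr_to_subalg Q (F k)"
    have [simp]: "sets ?P = sets (F k)" "sets ?Q = sets (F k)"
      using sets_restr_to_subalg[OF subalgebra_F[OF P(2)]] sets_restr_to_subalg[OF subalgebra_F[OF Q]]
      by auto
    interpret P: finite_measure ?P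
      by (rule finite_measure_restr_to_subalg[OF subalgebra_F[OF P(2)] P(1)])
    have "emeasure Q C = emeasure ?Q C"
      using emeasure_restr_to_subalg[OF subalgebra_F[OF Q] C] by simp
    also have "?Q = density ?P (RN_deriv ?P ?Q)"
      using ac by (intro P.density_RN_deriv[symmetric]) (auto simp: loc_absolutely_continuous_def)
    also have "emeasure \<dots> C = (\<integral>\<^sup>+\<omega>\<in>C. RN_deriv ?P ?Q \<omega> \<partial>?P)"
      using C by (intro emeasure_density) auto
    also have "\<dots> = (\<integral>\<^sup>+\<omega>\<in>C. ennreal (z k \<omega>) \<partial>?P)"
      using RN[of k] by (intro nn_integral_cong_AE) auto
    finally show ?thesis by simp
  qed
  have B: "\<And>k. k < n \<Longrightarrow> {\<omega>\<in>A. T \<omega> = enat k} \<in> sets (F k)" "{\<omega>\<in>A. enat n \<le> T \<omega>} \<in> sets (F n)"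
    "A \<subseteq> \<Omega>"
    using A by (auto simp: bounded_events_def)
  have FQ: "sets (F k) \<subseteq> sets Q" for k
    using subalgebra_F[OF Q, of k] by (auto simp: subalgebra_def)
  have BQ: "{\<omega>\<in>A. T \<omega> = enat k} \<in> sets Q" if "k < n" for k
    using B(1)[OF that] FQ by blast
  have BQ': "{\<omega>\<in>A. enat n \<le> T \<omega>} \<in> sets Q"
    using B(2) FQ by blast
  have "(\<integral>\<^sup>+\<omega>\<in>A. ennreal (stopped_value z n \<omega>) \<partial>P) =
      (\<integral>\<^sup>+\<omega>\<in>A. stopped_value (\<lambda>k \<omega>. ennreal (z k \<omega>)) n \<omega> \<partial>P)"
    by (intro nn_integral_cong) (simp add: stopped_value_def)
  also have "\<dots> = (\<Sum>k<n. emeasure Q {\<omega>\<in>A. T \<omega> = enat k}) + emeasure Q {\<omega>\<in>A. enat n \<le> T \<omega>}"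
    using B z by (subst nn_integral_stopped_value[OF P(2) _ A]) (auto simp: dens)
  also have "(\<Sum>k<n. emeasure Q {\<omega>\<in>A. T \<omega> = enat k}) = emeasure Q (\<Union>k<n. {\<omega>\<in>A. T \<omega> = enat k})"
    using BQ by (intro sum_emeasure) (auto simp: disjoint_family_on_def)
  also have "\<dots> + emeasure Q {\<omega>\<in>A. enat n \<le> T \<omega>} =
      emeasure Q ((\<Union>k<n. {\<omega>\<in>A. T \<omega> = enat k}) \<union> {\<omega>\<in>A. enat n \<le> T \<omega>})"
    using BQ BQ' by (intro plus_emeasure sets.finite_UN) auto
  also have "\<dots> = emeasure Q A"
    by (rule arg_cong[where f = "emeasure Q", OF bounded_events_decompose[OF B(3), symmetric]])
  finally show ?thesis .
qed

section \<open>Approximation by events known at a finite time\<close>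

text \<open>Induction over the generated \<sigma>-algebra: approximable sets include every
  \<open>F n\<close> and are closed under complements and countable unions. Adding the two measures
  makes one \<open>A\<close> serve both.\<close>

lemma approximate_generated_algebra:
  assumes M: "finite_measure M" "sets M = sets (generated_algebra \<Omega> F)"
    and N: "finite_measure N" "sets N = sets (generated_algebra \<Omega> F)"
    and B: "B \<in> sets (generated_algebra \<Omega> F)" and "0 < (e::real)"
  shows "\<exists>n. \<exists>A\<in>sets (F n). measure M (sym_diff A B) + measure N (sym_diff A B) < e"
proof -
  interpret M: finite_measure M by fact
  interpret N: finite_measure N by fact
  define d where "d A B = measure M (sym_diff A B) + measure N (sym_diff A B)" for A B
  define appr where "appr B \<longleftrightarrow> (\<forall>e>0. \<exists>n. \<exists>A\<in>sets (F n). d A B < e)" for B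
  let ?S = "sets (generated_algebra \<Omega> F)"
  have FS: "sets (F n) \<subseteq> ?S" for n by (auto simp: sets_generated_algebra)
  \<comment> \<open>Covers both uses: the triangle inequality and the comparison of unions.\<close>
  have d_mono: "d A B \<le> d A' B' + d A'' B''"
    if "sym_diff A B \<subseteq> sym_diff A' B' \<union> sym_diff A'' B''"
      "A \<in> ?S" "B \<in> ?S" "A' \<in> ?S" "B' \<in> ?S" "A'' \<in> ?S" "B'' \<in> ?S" for A B A' B' A'' B''
  proof -
    have "measure Q (sym_diff A B) \<le> measure Q (sym_diff A' B') + measure Q (sym_diff A'' B'')"
      if "finite_measure Q" "sets Q = ?S" for Q
    proof -
      interpret Q: finite_measure Q by fact
      have "measure Q (sym_diff A B) \<le> measure Q (sym_diff A' B' \<union> sym_diff A'' B'')"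
        using \<open>sym_diff A B \<subseteq> _\<close> \<open>A' \<in> ?S\<close> \<open>B' \<in> ?S\<close> \<open>A'' \<in> ?S\<close> \<open>B'' \<in> ?S\<close> that(2)
        by (intro Q.finite_measure_mono) auto
      also have "\<dots> \<le> measure Q (sym_diff A' B') + measure Q (sym_diff A'' B'')"
        using \<open>A' \<in> ?S\<close> \<open>B' \<in> ?S\<close> \<open>A'' \<in> ?S\<close> \<open>B'' \<in> ?S\<close> that(2)
        by (intro measure_Un_le) auto
      finally show ?thesis .
    qed
    from this[OF M] this[OF N] show ?thesis by (simp add: d_def)
  qed
  have appr_Un: "appr (B \<union> C)" if "appr B" "appr C" and BC: "B \<in> ?S" "C \<in> ?S" for B C
    unfolding appr_def
  proof (intro allI impI)
    fix e :: real assume "0 < e"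
    obtain m A where A: "A \<in> sets (F m)" "d A B < e / 2"
      using \<open>appr B\<close> \<open>0 < e\<close> unfolding appr_def by (meson half_gt_zero)
    obtain n A' where A': "A' \<in> sets (F n)" "d A' C < e / 2"
      using \<open>appr C\<close> \<open>0 < e\<close> unfolding appr_def by (meson half_gt_zero)
    have "d (A \<union> A') (B \<union> C) \<le> d A B + d A' C"
      using BC A(1) A'(1) FS[of m] FS[of n] by (intro d_mono) auto
    moreover have "A \<union> A' \<in> sets (F (max m n))"
      using A(1) A'(1) sets_F_mono[of m "max m n"] sets_F_mono[of n "max m n"] by auto
    ultimately show "\<exists>n. \<exists>A\<in>sets (F n). d A (B \<union> C) < e"
      using A(2) A'(2) by (intro exI[of _ "max m n"] bexI[of _ "A \<union> A'"]) auto
  qed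
  have "appr B" using B unfolding sets_generated_algebra
  proof (induction rule: sigma_sets.induct)
    case (Basic a)
    then obtain n where n: "a \<in> sets (F n)" by auto
    have "d a a = 0" by (simp add: d_def)
    with n show ?case unfolding appr_def by force
  next
    case Empty
    have "d {} {} = 0" by (simp add: d_def)
    then show ?case unfolding appr_def by (metis sets.empty_sets)
  next
    case (Compl a)
    have a: "a \<subseteq> \<Omega>"
      using sigma_sets_into_sp[OF sets_subset_Pow Compl.hyps] .
    have "d (\<Omega> - A) (\<Omega> - a) = d A a" if "A \<subseteq> \<Omega>" for A
    proof -
      have "sym_diff (\<Omega> - A) (\<Omega> - a) = sym_diff A a" using a that by auto
      then show ?thesis by (simp add: d_def)
    qed
    moreover have "\<Omega> - A \<in> sets (F n)" "A \<subseteq> \<Omega>" if "A \<in> sets (F n)" for A n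
      using that sets.compl_sets[OF that] sets.sets_into_space[OF that] by (auto simp: space_F)
    ultimately show ?case
      using Compl.IH unfolding appr_def by (metis (no_types))
  next
    case (Union a)
    have a: "a i \<in> ?S" for i using Union.hyps by (simp add: sets_generated_algebra)
    \<comment> \<open>A countable union is first replaced by a finite one, as only finitely many
      approximants share a common time \<open>n\<close>.\<close>
    have fin: "appr (\<Union>i<n. a i)" for n
    proof (induction n)
      case 0
      have "d {} {} = 0" by (simp add: d_def)
      then show ?case unfolding appr_def by (metis UN_empty lessThan_0 sets.empty_sets)
    next
      case (Suc n)
      then have "appr ((\<Union>i<n. a i) \<union> a n)" using a Union.IH by (intro appr_Un) auto
      then show ?case by (simp add: lessThan_Suc Un_commute)
    qed
    show ?case unfolding appr_def
    proof (intro allI impI)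
      fix e :: real assume "0 < e"
      have lim: "(\<lambda>n. measure Q (sym_diff (\<Union>i<n. a i) (\<Union>i. a i))) \<longlonglongrightarrow> 0"
        if "finite_measure Q" "sets Q = ?S" for Q
      proof -
        interpret Q: finite_measure Q by fact
        have "(\<lambda>n. measure Q (sym_diff (\<Union>i<n. a i) (\<Union>i. a i))) \<longlonglongrightarrow>
            measure Q (\<Inter>n. sym_diff (\<Union>i<n. a i) (\<Union>i. a i))"
          using a that(2) by (intro Q.finite_Lim_measure_decseq) (auto simp: decseq_def)
        moreover have "(\<Inter>n. sym_diff (\<Union>i<n. a i) (\<Union>i. a i)) = {}" by auto
        ultimately show ?thesis by simp
      qed
      have "(\<lambda>n. d (\<Union>i<n. a i) (\<Union>i. a i)) \<longlonglongrightarrow> 0 + 0"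
        unfolding d_def by (intro tendsto_add lim M N)
      then have "eventually (\<lambda>n. d (\<Union>i<n. a i) (\<Union>i. a i) < e / 2) sequentially"
        using \<open>0 < e\<close> by (intro order_tendstoD) auto
      then obtain k where k: "d (\<Union>i<k. a i) (\<Union>i. a i) < e / 2"
        by (auto simp: eventually_sequentially)
      obtain n A where A: "A \<in> sets (F n)" "d A (\<Union>i<k. a i) < e / 2"
        using fin[of k] \<open>0 < e\<close> unfolding appr_def by (meson half_gt_zero)
      have "d A (\<Union>i. a i) \<le> d A (\<Union>i<k. a i) + d (\<Union>i<k. a i) (\<Union>i. a i)"
        using a A(1) FS[of n] by (intro d_mono) auto
      with k A show "\<exists>n. \<exists>A\<in>sets (F n). d A (\<Union>i. a i) < e"
        by (intro exI[of _ n] bexI[of _ A]) auto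
    qed
  qed
  then show ?thesis using \<open>0 < e\<close> unfolding appr_def d_def by blast
qed

text \<open>On \<open>{T < n}\<close> an event of the stopped \<open>\<sigma>\<close>-algebra is already known at time \<open>min T n\<close>, so
  only its trace on \<open>{n \<le> T}\<close> has to be approximated.\<close>

lemma approximate_stopped_algebra:
  assumes M: "finite_measure M" "sets M = sets (generated_algebra \<Omega> F)"
    and N: "finite_measure N" "sets N = sets (generated_algebra \<Omega> F)"
    and B: "B \<in> sets (stopped_algebra \<Omega> F T)" and "0 < (e::real)"
  shows "\<exists>n\<ge>m. \<exists>A\<in>bounded_events n. measure M (sym_diff A B) + measure N (sym_diff A B) < e"
proof -
  interpret M: finite_measure M by fact
  interpret N: finite_measure N by fact
  note BB = B[unfolded sets_stopped_algebra[OF filtration_axioms stopping], simplified]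
  obtain j A where A: "A \<in> sets (F j)" "measure M (sym_diff A B) + measure N (sym_diff A B) < e"
    using approximate_generated_algebra[OF M N _ \<open>0 < e\<close>] BB by blast
  \<comment> \<open>The maximum lets the time be arbitrarily late, as the tails in the double lower
    limit demand.\<close>
  define n where "n = max m j"
  define A' where "A' = {\<omega>\<in>B. T \<omega> < enat n} \<union> {\<omega>\<in>A. enat n \<le> T \<omega>}"
  have \<Omega>: "A \<subseteq> \<Omega>" "B \<subseteq> \<Omega>"
    using sets.sets_into_space[OF A(1)] sets.sets_into_space[of B "generated_algebra \<Omega> F"] BB
    by (auto simp: space_F space_generated_algebra)
  have An: "A \<in> sets (F n)" using A(1) sets_F_mono[of j n] by (auto simp: n_def)
  have A': "A' \<in> bounded_events n"
    unfolding bounded_events_def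
  proof (intro CollectI conjI allI impI)
    show "A' \<subseteq> \<Omega>" using \<Omega> by (auto simp: A'_def)
    fix k assume "k < n"
    have "{\<omega>\<in>A'. T \<omega> = enat k} = {\<omega>\<in>B. T \<omega> \<le> enat k} \<inter> {\<omega>\<in>\<Omega>. T \<omega> = enat k}"
      using \<open>k < n\<close> \<Omega> by (auto simp: A'_def)
    then show "{\<omega>\<in>A'. T \<omega> = enat k} \<in> sets (F k)" using BB eq_sets_F[of k] by auto
  next
    have "{\<omega>\<in>A'. enat n \<le> T \<omega>} = A \<inter> {\<omega>\<in>\<Omega>. enat n \<le> T \<omega>}"
      using \<Omega> by (auto simp: A'_def)
    then show "{\<omega>\<in>A'. enat n \<le> T \<omega>} \<in> sets (F n)" using An ge_sets_F[of n] by auto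
  qed
  \<comment> \<open>\<open>A'\<close> agrees with \<open>B\<close> where \<open>T < n\<close> and
    with \<open>A\<close> elsewhere, so no new error arises.\<close>
  have sub: "sym_diff A' B \<subseteq> sym_diff A B" by (auto simp: A'_def not_le)
  have "sym_diff A B \<in> sets (generated_algebra \<Omega> F)"
    using subalgebra_F[of "generated_algebra \<Omega> F" j] A(1) BB by (auto simp: subalgebra_def)
  then have "measure M (sym_diff A' B) + measure N (sym_diff A' B) < e"
    using A(2) M.finite_measure_mono[OF sub] N.finite_measure_mono[OF sub] M(2) N(2) by simp
  moreover have "m \<le> n" by (simp add: n_def)
  ultimately show ?thesis using A' by blast
qed

end

section \<open>Integrated bounds for geometric means\<close>

text \<open>The pointwise bound is used with weight \<open>c\<close> on \<open>A\<close> and weight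
  1 off \<open>A\<close>. Non-negative terms are added so that both cases fit one bound; hence two
  integrals run over the whole space.\<close>

lemma nn_integral_geometric_mean_le:
  fixes f g :: "'a \<Rightarrow> real"
  assumes [measurable]: "f \<in> borel_measurable M" "g \<in> borel_measurable M" "A \<in> sets M"
    and nonneg: "\<And>\<omega>. \<omega> \<in> space M \<Longrightarrow> 0 \<le> f \<omega>" "\<And>\<omega>. \<omega> \<in> space M \<Longrightarrow> 0 \<le> g \<omega>"
    and "0 < c" "0 < x" "x < 1"
  shows "(\<integral>\<^sup>+\<omega>. ennreal (f \<omega> powr x * g \<omega> powr (1 - x)) \<partial>M) \<le>
    (\<integral>\<^sup>+\<omega>\<in>space M - A. ennreal (f \<omega>) \<partial>M) + ennreal (1 - x) * (\<integral>\<^sup>+\<omega>. ennreal (g \<omega>) \<partial>M) +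
    ennreal (c powr (x - 1)) * (\<integral>\<^sup>+\<omega>. ennreal (f \<omega>) \<partial>M) +
    ennreal (c powr x) * (\<integral>\<^sup>+\<omega>\<in>A. ennreal (g \<omega>) \<partial>M)"
proof -
  have "(\<integral>\<^sup>+\<omega>. ennreal (f \<omega> powr x * g \<omega> powr (1 - x)) \<partial>M) \<le>
    (\<integral>\<^sup>+\<omega>. ennreal (f \<omega>) * indicator (space M - A) \<omega> + ennreal (1 - x) * ennreal (g \<omega>) +
       ennreal (c powr (x - 1)) * ennreal (f \<omega>) +
       ennreal (c powr x) * (ennreal (g \<omega>) * indicator A \<omega>) \<partial>M)"
  proof (rule nn_integral_mono)
    fix \<omega> assume \<omega>: "\<omega> \<in> space M"
    note [simp] = nonneg[OF \<omega>]
    let ?y = "f \<omega> powr x * g \<omega> powr (1 - x)"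
    show "ennreal ?y \<le> ennreal (f \<omega>) * indicator (space M - A) \<omega> +
       ennreal (1 - x) * ennreal (g \<omega>) + ennreal (c powr (x - 1)) * ennreal (f \<omega>) +
       ennreal (c powr x) * (ennreal (g \<omega>) * indicator A \<omega>)"
    proof (cases "\<omega> \<in> A")
      case True
      have "?y \<le> c powr (x - 1) * f \<omega> * x + c powr x * g \<omega> * (1 - x)"
        using assms \<omega> by (intro powr_geometric_mean_le) auto
      also have "\<dots> \<le> c powr (x - 1) * f \<omega> * 1 + c powr x * g \<omega> * 1"
        using assms \<omega> by (intro add_mono mult_left_mono) auto
      also have "\<dots> \<le> (1 - x) * g \<omega> + c powr (x - 1) * f \<omega> + c powr x * g \<omega>"
        using assms \<omega> by simp
      finally show ?thesis
        using True \<open>x < 1\<close> by (simp flip: ennreal_mult ennreal_plus)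
    next
      case False
      have "?y \<le> 1 powr (x - 1) * f \<omega> * x + 1 powr x * g \<omega> * (1 - x)"
        using assms \<omega> by (intro powr_geometric_mean_le) auto
      also have "\<dots> \<le> f \<omega> * 1 + (1 - x) * g \<omega>"
        using assms \<omega> by (simp add: mult_left_le)
      also have "\<dots> \<le> f \<omega> + (1 - x) * g \<omega> + c powr (x - 1) * f \<omega>"
        using assms \<omega> by simp
      finally show ?thesis
        using False \<omega> \<open>x < 1\<close> by (simp flip: ennreal_mult ennreal_plus)
    qed
  qed
  also have "\<dots> = (\<integral>\<^sup>+\<omega>\<in>space M - A. ennreal (f \<omega>) \<partial>M) + ennreal (1 - x) * (\<integral>\<^sup>+\<omega>. ennreal (g \<omega>) \<partial>M) +
    ennreal (c powr (x - 1)) * (\<integral>\<^sup>+\<omega>. ennreal (f \<omega>) \<partial>M) +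
    ennreal (c powr x) * (\<integral>\<^sup>+\<omega>\<in>A. ennreal (g \<omega>) \<partial>M)"
    by (simp add: nn_integral_add nn_integral_cmult)
  finally show ?thesis .
qed

text \<open>Off the set \<open>f \<le> K * g\<close> the left integrand vanishes; on it
  \<open>powr_geometric_mean_ge\<close> applies.\<close>

lemma nn_integral_geometric_mean_ge:
  fixes f g :: "'a \<Rightarrow> real"
  assumes [measurable]: "f \<in> borel_measurable M" "g \<in> borel_measurable M"
    and nonneg: "\<And>\<omega>. \<omega> \<in> space M \<Longrightarrow> 0 \<le> f \<omega>"
    and "0 < K" "x < 1"
  shows "ennreal (K powr (x - 1)) * (\<integral>\<^sup>+\<omega>\<in>{\<omega>\<in>space M. f \<omega> \<le> K * g \<omega>}. ennreal (f \<omega>) \<partial>M) \<le>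
    (\<integral>\<^sup>+\<omega>. ennreal (f \<omega> powr x * g \<omega> powr (1 - x)) \<partial>M)"
proof -
  have "(\<integral>\<^sup>+\<omega>. ennreal (K powr (x - 1)) *
      (ennreal (f \<omega>) * indicator {\<omega>\<in>space M. f \<omega> \<le> K * g \<omega>} \<omega>) \<partial>M) \<le>
    (\<integral>\<^sup>+\<omega>. ennreal (f \<omega> powr x * g \<omega> powr (1 - x)) \<partial>M)"
  proof (rule nn_integral_mono)
    fix \<omega> assume \<omega>: "\<omega> \<in> space M"
    show "ennreal (K powr (x - 1)) * (ennreal (f \<omega>) * indicator {\<omega>\<in>space M. f \<omega> \<le> K * g \<omega>} \<omega>)
      \<le> ennreal (f \<omega> powr x * g \<omega> powr (1 - x))"
    proof (cases "f \<omega> \<le> K * g \<omega>")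
      case True
      then show ?thesis
        using powr_geometric_mean_ge[of "f \<omega>" K "g \<omega>" x] assms \<omega>
        by (simp add: nonneg flip: ennreal_mult)
    qed simp
  qed
  then show ?thesis by (simp add: nn_integral_cmult)
qed

section \<open>Mass of the absolutely continuous part as a double lower limit\<close>

theorem corollary3:
  fixes \<Omega> :: "'a set" and F :: "nat \<Rightarrow> 'a measure"
    and \<mu> \<nu> P :: "'a measure"
    and z z' :: "nat \<Rightarrow> 'a \<Rightarrow> real"
    and T :: "'a \<Rightarrow> enat"
  assumes "filtration \<Omega> F"
    and "prob_space \<mu>" and "sets \<mu> = sets (generated_algebra \<Omega> F)"
    and "prob_space \<nu>" and "sets \<nu> = sets (generated_algebra \<Omega> F)"
    and "prob_space P" and "sets P = sets (generated_algebra \<Omega> F)"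
    and "loc_absolutely_continuous F P \<mu>"
    and "loc_absolutely_continuous F P \<nu>"
    and "\<And>n. z n \<in> borel_measurable (F n)"
    and "\<And>n \<omega>. \<omega> \<in> \<Omega> \<Longrightarrow> 0 \<le> z n \<omega>"
    and "\<And>n. AE \<omega> in restr_to_subalg P (F n).
           ennreal (z n \<omega>) = RN_deriv (restr_to_subalg P (F n)) (restr_to_subalg \<mu> (F n)) \<omega>"
    and "\<And>n. z' n \<in> borel_measurable (F n)"
    and "\<And>n \<omega>. \<omega> \<in> \<Omega> \<Longrightarrow> 0 \<le> z' n \<omega>"
    and "\<And>n. AE \<omega> in restr_to_subalg P (F n).
           ennreal (z' n \<omega>) = RN_deriv (restr_to_subalg P (F n)) (restr_to_subalg \<nu> (F n)) \<omega>"
    and "stopping_time (enat_filtration \<Omega> F) T"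
  shows "tv_norm (ac_part (restr_to_subalg \<nu> (stopped_algebra \<Omega> F T))
                          (restr_to_subalg \<mu> (stopped_algebra \<Omega> F T))) =
    double_liminf (\<lambda>\<alpha> n.
      (\<Sum>k<n. \<integral>\<^sup>+\<omega>\<in>{\<omega>\<in>\<Omega>. T \<omega> = enat k}. ennreal (Y_process z z' k \<alpha> \<omega>) \<partial>restr_to_subalg P (F k)) +
      (\<integral>\<^sup>+\<omega>\<in>{\<omega>\<in>\<Omega>. enat n \<le> T \<omega>}. ennreal (Y_process z z' n \<alpha> \<omega>) \<partial>restr_to_subalg P (F n)))"
proof -
  interpret stopped_filtration \<Omega> F T
    using assms(1,16) by (simp add: stopped_filtration_def stopped_filtration_axioms_def)
  interpret \<mu>: prob_space \<mu> by fact
  interpret \<nu>: prob_space \<nu> by fact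
  interpret P: prob_space P by fact
  let ?G = "stopped_algebra \<Omega> F T"
  let ?M = "restr_to_subalg \<mu> ?G" and ?N = "restr_to_subalg \<nu> ?G"
  let ?Z = "stopped_value z" and ?Z' = "stopped_value z'"
  have subM: "subalgebra \<mu> ?G" and subN: "subalgebra \<nu> ?G" and subP: "subalgebra P ?G"
    using assms(3,5,7) by (auto intro: subalgebra_stopped_algebra)
  have sM [simp]: "sets ?M = sets ?G" and sN [simp]: "sets ?N = sets ?G"
    using subM subN by (auto simp: sets_restr_to_subalg)
  have sp [simp]: "space \<mu> = \<Omega>" "space \<nu> = \<Omega>" "space P = \<Omega>" "space ?G = \<Omega>"
    using sets_eq_imp_space_eq[OF assms(3)] sets_eq_imp_space_eq[OF assms(5)]
      sets_eq_imp_space_eq[OF assms(7)] subM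
    by (auto simp: space_generated_algebra subalgebra_def)
  have GS: "sets ?G \<subseteq> sets \<mu>" "sets ?G \<subseteq> sets \<nu>" "sets ?G \<subseteq> sets P"
    using subM subN subP by (auto simp: subalgebra_def)
  interpret M: prob_space ?M by (rule prob_space_restr_to_subalg[OF subM assms(2)])
  interpret N: prob_space ?N by (rule prob_space_restr_to_subalg[OF subN assms(4)])
  have eN: "emeasure ?N A = emeasure \<nu> A" and eM: "emeasure ?M A = emeasure \<mu> A"
    if "A \<in> sets ?G" for A
    using that by (auto simp: emeasure_restr_to_subalg[OF subN] emeasure_restr_to_subalg[OF subM])
  define L where "L = ac_part ?N ?M"
  obtain B where B: "B \<in> null_sets ?N" and ac: "absolutely_continuous ?N L"
    and sL: "sets L = sets ?N" and L: "\<And>A. A \<in> sets ?N \<Longrightarrow> emeasure L A = emeasure ?M (A - B)"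
    unfolding L_def by (rule ac_part_emeasure[of ?M ?N]) (auto intro: M.finite_measure_axioms)
  have BG: "B \<in> sets ?G" using B by auto
  then have BS: "B \<in> sets \<mu>" "B \<in> sets \<nu>" using GS by auto
  have \<Omega>G: "\<Omega> \<in> sets ?G" using sets.top[of ?G] by simp
  have \<nu>B: "measure \<nu> B = 0" using null_setsD1[OF B] eN[OF BG] by (simp add: measure_def)
  have spL: "space L = \<Omega>"
    using sets_eq_imp_space_eq[OF sL] by (simp add: space_restr_to_subalg)
  have L': "emeasure L A = emeasure \<mu> (A - B)" if "A \<in> sets ?G" for A
    using that L[of A] eM[of "A - B"] BG by auto
  have finL: "finite_measure L"
    by (rule finite_measureI) (simp add: spL L' \<Omega>G \<mu>.emeasure_eq_measure)
  interpret L: finite_measure L by fact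
  have mL: "measure L A = measure \<mu> (A - B)" if "A \<in> sets ?G" for A
    using L'[OF that] by (simp add: measure_def)
  define m where "m = measure \<mu> (\<Omega> - B)"
  have "0 \<le> m" by (simp add: m_def)
  have tv: "tv_norm L = ennreal m"
    by (simp add: tv_norm_eq_emeasure_space spL L' \<Omega>G \<mu>.emeasure_eq_measure m_def)

  define H where "H x n =
      (\<Sum>k<n. \<integral>\<^sup>+\<omega>\<in>{\<omega>\<in>\<Omega>. T \<omega> = enat k}. ennreal (Y_process z z' k x \<omega>) \<partial>restr_to_subalg P (F k)) +
      (\<integral>\<^sup>+\<omega>\<in>{\<omega>\<in>\<Omega>. enat n \<le> T \<omega>}. ennreal (Y_process z z' n x \<omega>) \<partial>restr_to_subalg P (F n))" for x n
  have \<Omega>b: "\<Omega> \<in> bounded_events n" for n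
    using eq_sets_F ge_sets_F by (auto simp: bounded_events_def)
  \<comment> \<open>Stopping commutes with forming \<open>Y_process\<close>, so the bracket is one
    integral over the stopped densities.\<close>
  have H: "H x n = (\<integral>\<^sup>+\<omega>. ennreal (?Z n \<omega> powr x * ?Z' n \<omega> powr (1 - x)) \<partial>P)" for x n
  proof -
    have "(\<lambda>\<omega>. ennreal (Y_process z z' k x \<omega>)) \<in> borel_measurable (F k)" for k
      unfolding Y_process_def using assms(10,13) by measurable
    then have "H x n = (\<integral>\<^sup>+\<omega>\<in>\<Omega>. stopped_value (\<lambda>k \<omega>. ennreal (Y_process z z' k x \<omega>)) n \<omega> \<partial>P)"
      unfolding H_def by (subst nn_integral_stopped_value[OF assms(7) _ \<Omega>b]) auto
    also have "\<dots> = (\<integral>\<^sup>+\<omega>. ennreal (?Z n \<omega> powr x * ?Z' n \<omega> powr (1 - x)) \<partial>P)"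
      by (intro nn_integral_cong) (auto simp: stopped_value_def Y_process_def)
    finally show ?thesis .
  qed
  have meas [measurable]: "?Z n \<in> borel_measurable P" "?Z' n \<in> borel_measurable P" for n
    using assms(10,13) by (auto intro!: measurable_from_subalg[OF subalgebra_F[OF assms(7)]] stopped_value_measurable)
  have nonneg: "0 \<le> ?Z n \<omega>" "0 \<le> ?Z' n \<omega>" if "\<omega> \<in> \<Omega>" for n \<omega>
    using assms(11,14) that by (auto simp: stopped_value_def)
  note \<mu>A = emeasure_bounded_events[OF P.finite_measure_axioms assms(7,3,8,10,12)]
  note \<nu>A = emeasure_bounded_events[OF P.finite_measure_axioms assms(7,5,9,13,15)]
  have \<mu>1: "(\<integral>\<^sup>+\<omega>. ennreal (?Z n \<omega>) \<partial>P) = 1" for n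
  proof -
    have "(\<integral>\<^sup>+\<omega>. ennreal (?Z n \<omega>) \<partial>P) = (\<integral>\<^sup>+\<omega>\<in>\<Omega>. ennreal (?Z n \<omega>) \<partial>P)"
      by (intro nn_integral_cong) simp
    then show ?thesis using \<mu>A[OF \<Omega>b] \<mu>.emeasure_space_1 by simp
  qed
  have \<nu>1: "(\<integral>\<^sup>+\<omega>. ennreal (?Z' n \<omega>) \<partial>P) = 1" for n
  proof -
    have "(\<integral>\<^sup>+\<omega>. ennreal (?Z' n \<omega>) \<partial>P) = (\<integral>\<^sup>+\<omega>\<in>\<Omega>. ennreal (?Z' n \<omega>) \<partial>P)"
      by (intro nn_integral_cong) simp
    then show ?thesis using \<nu>A[OF \<Omega>b] \<nu>.emeasure_space_1 by simp
  qed

  \<comment> \<open>Upper bound along every tail\<close>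
  have upper: "\<exists>k\<ge>n. \<exists>x\<in>{\<beta>..<1}. H x k \<le> ennreal (m + e)"
    if "0 < \<beta>" "\<beta> < 1" "0 < e" for n \<beta> e
  proof -
    \<comment> \<open>The choices go in the order \<open>x\<close>, \<open>c\<close>,
      \<open>\<epsilon>\<close>, \<open>A\<close>. Here the term \<open>1 - x\<close> is kept to
      \<open>e / 4\<close>.\<close>
    define x where "x = max \<beta> (1 - e / 4)"
    have x: "\<beta> \<le> x" "0 < x" "x < 1" "1 - x \<le> e / 4" using that by (auto simp: x_def max_def)
    \<comment> \<open>Solves \<open>c powr (x - 1) = e / 4\<close>; the exponent is negative, so
      small \<open>e\<close> means large \<open>c\<close>.\<close>
    define c where "c = (e / 4) powr (1 / (x - 1))"
    have c: "0 < c" "c powr (x - 1) = e / 4" using x that by (auto simp: c_def powr_powr)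
    \<comment> \<open>One \<open>\<epsilon>\<close> pays for the approximation error under \<mu>,
      and \<open>c powr x * \<epsilon>\<close> for the weighted \<nu>-mass of \<open>A\<close>;
      together they cost \<open>e / 4\<close>.\<close>
    define \<epsilon> where "\<epsilon> = (e / 4) / (1 + c powr x)"
    have c1: "0 < 1 + c powr x" by (simp add: add_pos_nonneg)
    then have "\<epsilon> * (1 + c powr x) = e / 4"
      using nonzero_eq_divide_eq[of "1 + c powr x" \<epsilon> "e / 4"] \<epsilon>_def by simp
    then have \<epsilon>: "0 < \<epsilon>" "\<epsilon> + c powr x * \<epsilon> = e / 4"
      using that c1 by (simp add: \<epsilon>_def, simp add: algebra_simps)
    obtain k A where k: "n \<le> k" and A: "A \<in> bounded_events k"
      and d: "measure \<mu> (sym_diff A B) + measure \<nu> (sym_diff A B) < \<epsilon>"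
      using approximate_stopped_algebra[OF \<mu>.finite_measure_axioms assms(3)
          \<nu>.finite_measure_axioms assms(5) BG \<epsilon>(1)] by blast
    have AG: "A \<in> sets ?G" using bounded_events_stopped_algebra[OF A] .
    then have AS: "A \<in> sets \<mu>" "A \<in> sets \<nu>" "A \<in> sets P" using GS by auto
    have cA: "\<Omega> - A \<in> bounded_events k" using bounded_events_Compl[OF A] .
    have "measure \<nu> A \<le> measure \<nu> (sym_diff A B \<union> B)"
      using AS BS by (intro \<nu>.finite_measure_mono) auto
    also have "\<dots> \<le> measure \<nu> (sym_diff A B) + measure \<nu> B"
      using AS BS by (intro measure_Un_le) auto
    also have "\<dots> \<le> \<epsilon>" using d \<nu>B measure_nonneg[of \<mu> "sym_diff A B"] by linarith
    finally have \<nu>le: "measure \<nu> A \<le> \<epsilon>" .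
    have \<Omega>S: "\<Omega> \<in> sets \<mu>" using \<Omega>G GS by auto
    have "measure \<mu> (\<Omega> - A) \<le> measure \<mu> ((\<Omega> - B) \<union> sym_diff A B)"
      using AS BS \<Omega>S by (intro \<mu>.finite_measure_mono) auto
    also have "\<dots> \<le> m + measure \<mu> (sym_diff A B)"
      unfolding m_def using AS BS \<Omega>S by (intro measure_Un_le) auto
    also have "\<dots> \<le> m + \<epsilon>" using d measure_nonneg[of \<nu> "sym_diff A B"] by linarith
    finally have \<mu>le: "measure \<mu> (\<Omega> - A) \<le> m + \<epsilon>" .
    have "H x k \<le> emeasure \<mu> (\<Omega> - A) + ennreal (1 - x) * 1 + ennreal (c powr (x - 1)) * 1 +
        ennreal (c powr x) * emeasure \<nu> A"
      unfolding H using nn_integral_geometric_mean_le[of "?Z k" P "?Z' k" A c x] AS nonneg c(1) x(2,3)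
      by (simp add: \<mu>1 \<nu>1 \<mu>A[OF cA] \<nu>A[OF A])
    also have "\<dots> = ennreal (measure \<mu> (\<Omega> - A) + (1 - x) + e / 4 + c powr x * measure \<nu> A)"
      using x c(2) that by (simp add: \<mu>.emeasure_eq_measure \<nu>.emeasure_eq_measure flip: ennreal_mult ennreal_plus)
    also have "\<dots> \<le> ennreal (m + e)"
    proof (rule ennreal_leI)
      have "c powr x * measure \<nu> A \<le> c powr x * \<epsilon>" using \<nu>le by (intro mult_left_mono) auto
      then show "measure \<mu> (\<Omega> - A) + (1 - x) + e / 4 + c powr x * measure \<nu> A \<le> m + e"
        using \<mu>le x(4) \<epsilon>(2) that by linarith
    qed
    finally have "H x k \<le> ennreal (m + e)" .
    moreover have "x \<in> {\<beta>..<1}" using x by simp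
    ultimately show ?thesis using k by blast
  qed

  \<comment> \<open>Lower bound, uniform in the time\<close>
  have lower: "\<exists>\<beta>\<in>{0<..<1}. \<forall>k. \<forall>x\<in>{\<beta>..<1}. ennreal m \<le> H x k + ennreal e"
    if "0 < e" for e :: real
  proof -
    obtain d :: real where d: "0 < d" "\<And>C. C \<in> sets ?N \<Longrightarrow> measure ?N C \<le> d \<Longrightarrow> measure L C < e / 2"
      by (rule absolutely_continuous_epsilon_delta[OF finL N.finite_measure_axioms ac sL
            half_gt_zero[OF \<open>0 < e\<close>]]) blast
    \<comment> \<open>\<open>1 / K \<le> d\<close> will make the complement of \<open>D\<close>
      small enough for \<open>d\<close>; \<open>K \<ge> 1\<close> makes \<open>K powr y\<close>
      increasing in \<open>y\<close>, so the choice of \<open>\<beta>\<close> carries over to all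
      \<open>x \<ge> \<beta>\<close>.\<close>
    define K where "K = max 1 (1 / d)"
    have K: "1 \<le> K" "1 / K \<le> d" using d(1) by (auto simp: K_def field_simps max_def)
    have "((\<lambda>x. K powr (x - 1)) \<longlongrightarrow> K powr (1 - 1)) (at_left 1)"
      using K by (intro tendsto_intros) auto
    then have "eventually (\<lambda>x. 1 - e / 2 < K powr (x - 1)) (at_left 1)"
      using that K by (intro order_tendstoD) auto
    moreover have "eventually (\<lambda>x. x \<in> {0<..<1::real}) (at_left 1)"
      using eventually_at_left_real[of 0 "1::real"] by simp
    ultimately have "eventually (\<lambda>x. x \<in> {0<..<1::real} \<and> 1 - e / 2 < K powr (x - 1)) (at_left 1)"
      by eventually_elim auto
    then obtain \<beta> where \<beta>: "\<beta> \<in> {0<..<1::real}" "1 - e / 2 < K powr (\<beta> - 1)"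
      using eventually_happens trivial_limit_at_left_real[of "1::real"] by blast
    have "ennreal m \<le> H x k + ennreal e" if x: "x \<in> {\<beta>..<1}" for x k
    proof -
      define D where "D = {\<omega>\<in>\<Omega>. ?Z k \<omega> \<le> K * ?Z' k \<omega>}"
      have "{\<omega>\<in>\<Omega>. stopped_value (\<lambda>j \<omega>. z j \<omega> \<le> K * z' j \<omega>) k \<omega>} \<in> bounded_events k"
      proof (rule stopped_value_pred_bounded_events)
        fix j
        have [measurable]: "z j \<in> borel_measurable (F j)" "z' j \<in> borel_measurable (F j)"
          using assms(10,13) by auto
        have "{\<omega>\<in>space (F j). z j \<omega> \<le> K * z' j \<omega>} \<in> sets (F j)" by measurable
        then show "{\<omega>\<in>\<Omega>. z j \<omega> \<le> K * z' j \<omega>} \<in> sets (F j)" by (simp add: space_F)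
      qed
      moreover have "{\<omega>\<in>\<Omega>. stopped_value (\<lambda>j \<omega>. z j \<omega> \<le> K * z' j \<omega>) k \<omega>} = D"
        by (auto simp: D_def stopped_value_def)
      ultimately have D: "D \<in> bounded_events k" "\<Omega> - D \<in> bounded_events k"
        using bounded_events_Compl by auto
      have DG: "D \<in> sets ?G" "\<Omega> - D \<in> sets ?G"
        using D[THEN bounded_events_stopped_algebra] by auto
      \<comment> \<open>A Markov-type estimate: off \<open>D\<close> the stopped densities satisfy
        \<open>K * Z' < Z\<close>, and \<open>Z\<close> has integral 1.\<close>
      have "ennreal K * emeasure \<nu> (\<Omega> - D) = (\<integral>\<^sup>+\<omega>. ennreal K * (ennreal (?Z' k \<omega>) * indicator (\<Omega> - D) \<omega>) \<partial>P)"
        using DG GS by (subst \<nu>A[OF D(2), symmetric], subst nn_integral_cmult) auto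
      also have "\<dots> \<le> (\<integral>\<^sup>+\<omega>. ennreal (?Z k \<omega>) \<partial>P)"
        using K nonneg by (intro nn_integral_mono)
          (auto simp: D_def indicator_def intro!: ennreal_leI simp flip: ennreal_mult)
      finally have "K * measure \<nu> (\<Omega> - D) \<le> 1"
        using K by (simp add: \<mu>1 \<nu>.emeasure_eq_measure flip: ennreal_mult)
      then have "measure \<nu> (\<Omega> - D) \<le> 1 / K" using K by (simp add: field_simps)
      with K have "measure ?N (\<Omega> - D) \<le> d"
        using eN[OF DG(2)] by (simp add: measure_def)
      then have LD: "measure L (\<Omega> - D) < e / 2" using d(2) DG by simp
      \<comment> \<open>\<open>L\<close> has total mass \<open>m\<close> and is dominated by \<mu>,
        so \<open>D\<close> keeps \<mu>-mass at least \<open>m - e / 2\<close>.\<close>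
      have "measure L (\<Omega> - D) = measure L \<Omega> - measure L D"
        using L.finite_measure_compl[of D] DG sL spL by simp
      then have "m - e / 2 \<le> measure L D" using LD mL[OF \<Omega>G] by (simp add: m_def)
      also have "\<dots> \<le> measure \<mu> D"
        unfolding mL[OF DG(1)] using DG GS by (intro \<mu>.finite_measure_mono) auto
      finally have D1: "m - e / 2 \<le> measure \<mu> D" .
      have "K powr (\<beta> - 1) \<le> K powr (x - 1)" using K x by (intro powr_mono) auto
      then have D2: "1 - e / 2 \<le> K powr (x - 1)" using \<beta> by simp
      \<comment> \<open>The second loss of \<open>e / 2\<close>, using that \<mu> has mass at most 1
        on \<open>D\<close>.\<close>
      have D3: "K powr (x - 1) * measure \<mu> D \<ge> measure \<mu> D - e / 2"
      proof -
        have "(1 - e / 2) * measure \<mu> D \<le> K powr (x - 1) * measure \<mu> D"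
          using D2 by (intro mult_right_mono) auto
        moreover have "e / 2 * measure \<mu> D \<le> e / 2"
          using \<open>0 < e\<close> by (simp add: mult_left_le)
        ultimately show ?thesis by (simp add: algebra_simps)
      qed
      have "ennreal (K powr (x - 1) * measure \<mu> D) = ennreal (K powr (x - 1)) * emeasure \<mu> D"
        by (simp add: \<mu>.emeasure_eq_measure ennreal_mult)
      also have "\<dots> \<le> H x k"
        unfolding H \<mu>A[OF D(1), symmetric]
        using nn_integral_geometric_mean_ge[of "?Z k" P "?Z' k" K x] nonneg K x by (simp add: D_def)
      finally have "ennreal (K powr (x - 1) * measure \<mu> D) + ennreal e \<le> H x k + ennreal e"
        by (rule add_right_mono)
      moreover have "ennreal m \<le> ennreal (K powr (x - 1) * measure \<mu> D) + ennreal e"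
        using D1 D3 \<open>0 < e\<close> by (simp flip: ennreal_plus)
      ultimately show ?thesis by (rule order_trans[rotated])
    qed
    with \<beta>(1) show ?thesis by blast
  qed

  \<comment> \<open>Assembling the double lower limit\<close>
  have "double_liminf H = ennreal m"
  proof (rule antisym)
    show "double_liminf H \<le> ennreal m"
      unfolding double_liminf_def
    proof (rule SUP_least, clarify)
      fix n :: nat and \<beta> :: real assume \<beta>: "\<beta> \<in> {0<..<1}"
      show "(INF (k, x)\<in>{n..} \<times> {\<beta>..<1}. H x k) \<le> ennreal m"
      proof (rule ennreal_le_epsilon)
        fix e :: real assume "0 < e"
        then obtain k x where "n \<le> k" "x \<in> {\<beta>..<1}" "H x k \<le> ennreal (m + e)"
          using upper[of \<beta> e n] \<beta> by auto
        then have "(INF (k, x)\<in>{n..} \<times> {\<beta>..<1}. H x k) \<le> ennreal (m + e)"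
          by (intro INF_lower2[of "(k, x)"]) auto
        then show "(INF (k, x)\<in>{n..} \<times> {\<beta>..<1}. H x k) \<le> ennreal m + ennreal e"
          using \<open>0 < e\<close> \<open>0 \<le> m\<close> by simp
      qed
    qed
    show "ennreal m \<le> double_liminf H"
    proof (rule ennreal_le_epsilon)
      fix e :: real assume "0 < e"
      then obtain \<beta> where \<beta>: "\<beta> \<in> {0<..<1}" "\<And>k x. x \<in> {\<beta>..<1} \<Longrightarrow> ennreal m \<le> H x k + ennreal e"
        using lower by blast
      \<comment> \<open>The bound from \<open>lower\<close> holds at every time, so the tail
        starting at 0 already witnesses the supremum.\<close>
      have "ennreal m - ennreal e \<le> (INF (k, x)\<in>{0..} \<times> {\<beta>..<1}. H x k)"
        using \<beta>(2) by (intro INF_greatest) (auto simp: ennreal_minus_le_iff add.commute)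
      also have "\<dots> \<le> double_liminf H"
        unfolding double_liminf_def using \<beta>(1) by (intro SUP_upper2[of "(0, \<beta>)"]) auto
      finally show "ennreal m \<le> double_liminf H + ennreal e"
        by (simp add: ennreal_minus_le_iff add.commute)
    qed
  qed
  then show ?thesis
    using tv unfolding L_def H_def[abs_def] by simp
qed

end
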